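(* Let $c \in \mathbb{C}\setminus\{0\}$, and let $Z$ be a $\mathbb{C}\setminus\{0\}$-valued random variable on a probability space such that $$\operatorname{Range}[Z] \subset \{ z \in \mathbb{C} \mid c\cdot z \ge a \}\cap\{ z \in \mathbb{C} \mid |z| \le R \}$$ for some $a > 0$ and $R < \infty$. Then $$c\cdot \mathbf{H}[Z] \ge \mathbf{H}[c\cdot Z].$$ Moreover, equality holds when $Z = vX$ for some constant $v \in \mathbb{C}\setminus\{0\}$ and some $(0,\infty)$-valued random variable $X$.
   Context: For complex numbers $c,z$, the real inner product is $c\cdot z := \operatorname{Re}(\overline{c}z)$. For a complex-valued random variable $Z$, $\operatorname{Range}[Z]$ denotes the support of the distribution of $Z$. For a $\mathbb{C}\setminus\{0\}$-valued random variable $Z$, the complex harmonic mean is $\mathbf{H}[Z] := \mathbf{E}[Z^{-1}]^{-1}$, defined whenever $\mathbf{E}[Z^{-1}]$ exists and is a non-zero complex number. For a $(0,\infty)$-valued random variable $X$, the classical harmonic mean is $\mathbf{H}[X] := \mathbf{E}[X^{-1}]^{-1}$, defined whenever $\mathbf{E}[X^{-1}]$ exists as a positive number. Here $c\cdot Z$ is (almost surely) a positive-valued random variable, and the range condition guarantees that both $\mathbf{H}[Z]$ and $\mathbf{H}[c\cdot Z]$ exist. *)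

theory Defs
  imports "HOL-Probability.Probability"
begin

text \<open>The real inner product of two complex numbers is the library's \<^const>\<open>inner\<close>,
  which coincides with \<open>Re (cnj c * z)\<close>.\<close>

lemma inner_complex_eq_Re: "inner c z = Re (cnj c * z)" for c z :: complex
  by (simp add: inner_complex_def)

text \<open>The support of the distribution of \<open>Z\<close>; not to be confused with the image \<open>Z ` space M\<close>.\<close>

definition rv_range :: "'a measure \<Rightarrow> ('a \<Rightarrow> 'b::topological_space) \<Rightarrow> 'b set" where
  "rv_range M Z = {z. \<forall>U. open U \<and> z \<in> U \<longrightarrow> measure (distr M borel Z) U > 0}"

text \<open>Both harmonic means are partial notions: the functions below carry their intended meaning
  only together with the corresponding existence predicate. The predicates impose non-vanishing
  and positivity almost surely, because \<open>inner c (Z \<omega>)\<close> need only be positive off a null set.\<close>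

definition complex_harmonic_mean_exists :: "'a measure \<Rightarrow> ('a \<Rightarrow> complex) \<Rightarrow> bool" where
  "complex_harmonic_mean_exists M Z \<longleftrightarrow>
     (AE \<omega> in M. Z \<omega> \<noteq> 0) \<and>
     integrable M (\<lambda>\<omega>. inverse (Z \<omega>)) \<and>
     (\<integral>\<omega>. inverse (Z \<omega>) \<partial>M) \<noteq> 0"

definition complex_harmonic_mean :: "'a measure \<Rightarrow> ('a \<Rightarrow> complex) \<Rightarrow> complex" where
  "complex_harmonic_mean M Z = inverse (\<integral>\<omega>. inverse (Z \<omega>) \<partial>M)"

definition real_harmonic_mean_exists :: "'a measure \<Rightarrow> ('a \<Rightarrow> real) \<Rightarrow> bool" where
  "real_harmonic_mean_exists M X \<longleftrightarrow>
     (AE \<omega> in M. X \<omega> > 0) \<and>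
     integrable M (\<lambda>\<omega>. inverse (X \<omega>)) \<and>
     (\<integral>\<omega>. inverse (X \<omega>) \<partial>M) > 0"

definition real_harmonic_mean :: "'a measure \<Rightarrow> ('a \<Rightarrow> real) \<Rightarrow> real" where
  "real_harmonic_mean M X = inverse (\<integral>\<omega>. inverse (X \<omega>) \<partial>M)"

end

theory Submission
  imports Defs
begin

text \<open>With \<open>S = c / Z\<close> one has \<open>1 / (c \<cdot> Z) = \<bar>S\<bar>\<^sup>2 / (\<bar>c\<bar>\<^sup>2 Re S)\<close>, and the same formula
  relates \<open>H[Z]\<close> to \<open>E[S]\<close>. On the half-plane \<open>Re s > 0\<close> the function
  \<open>\<bar>s\<bar>\<^sup>2 / Re s = Re s + (Im s)\<^sup>2 / Re s\<close> is convex, so the inequality is Jensen's, obtained by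
  integrating the tangent plane at \<open>E[S]\<close>.\<close>

text \<open>The complement of the support is a union of null sets from a countable basis, hence
  null. This turns a hypothesis on the support into an almost sure statement about
  \<open>Z\<close>.\<close>

lemma AE_in_rv_range:
  fixes Z :: "'a \<Rightarrow> 'b::second_countable_topology"
  assumes "prob_space M" and Z[measurable]: "Z \<in> borel_measurable M"
  shows "AE \<omega> in M. Z \<omega> \<in> rv_range M Z"
proof -
  interpret prob_space M by fact
  interpret D: prob_space "distr M borel Z" by (rule prob_space_distr) simp
  obtain B :: "'b set set" where B: "countable B" "topological_basis B"
    using ex_countable_basis by blast
  define N where "N = {U \<in> B. measure (distr M borel Z) U = 0}"
  have "countable N"
    using B(1) by (auto simp: N_def)
  moreover have "AE \<omega> in M. Z \<omega> \<notin> U" if "U \<in> N" for U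
  proof -
    have U: "U \<in> sets borel" "measure (distr M borel Z) U = 0"
      using that topological_basis_open[OF B(2)] by (auto simp: N_def)
    then have "AE z in distr M borel Z. z \<notin> U"
      by (intro AE_not_in) (auto simp: null_sets_def D.emeasure_eq_measure)
    then show ?thesis
      using U(1) by (subst (asm) AE_distr_iff) auto
  qed
  ultimately have "AE \<omega> in M. \<forall>U\<in>N. Z \<omega> \<notin> U"
    by (simp add: AE_ball_countable)
  then show ?thesis
  proof eventually_elim
    case (elim \<omega>)
    show ?case
      unfolding rv_range_def
    proof safe
      fix V assume V: "open V" "Z \<omega> \<in> V"
      then obtain U where U: "U \<in> B" "Z \<omega> \<in> U" "U \<subseteq> V"
        using topological_basisE[OF B(2)] by metis
      then have "0 < measure (distr M borel Z) U"
        using elim by (auto simp: N_def zero_less_measure_iff)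
      also have "\<dots> \<le> measure (distr M borel Z) V"
        using U(3) V(1) by (intro D.finite_measure_mono) auto
      finally show "0 < measure (distr M borel Z) V" .
    qed
  qed
qed

lemma Re_divide_eq_inner: "Re (c / z) = inner c z / (cmod z)\<^sup>2"
  by (simp add: Re_divide inner_complex_def cmod_power2)

text \<open>No case distinction is needed: with \<open>x / 0 = 0\<close> both sides vanish together.\<close>

lemma norm_square_divide_inner:
  "(cmod c)\<^sup>2 / inner c z = (cmod (c / z))\<^sup>2 / Re (c / z)"
  by (cases "z = 0") (simp_all add: Re_divide_eq_inner norm_divide power_divide)

text \<open>The left side is the tangent plane of \<open>x + y^2 / x\<close> along the ray
  \<open>y = k * x\<close>; it has no constant term because that function is homogeneous of degree
  one. The gap is a square over \<open>Re s\<close>.\<close>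

lemma norm_square_divide_Re_tangent:
  assumes "Re s > 0"
  shows "(1 - k\<^sup>2) * Re s + 2 * k * Im s \<le> (cmod s)\<^sup>2 / Re s"
proof -
  have "(cmod s)\<^sup>2 / Re s - ((1 - k\<^sup>2) * Re s + 2 * k * Im s) = (Im s - k * Re s)\<^sup>2 / Re s"
    unfolding cmod_power2 using assms by (simp add: field_simps power2_eq_square)
  also have "\<dots> \<ge> 0"
    using assms by simp
  finally show ?thesis by simp
qed

lemma (in prob_space) expectation_norm_square_divide_Re:
  fixes S :: "'a \<Rightarrow> complex"
  assumes S: "integrable M S" and pos: "AE \<omega> in M. Re (S \<omega>) > 0"
    and Q: "integrable M (\<lambda>\<omega>. (cmod (S \<omega>))\<^sup>2 / Re (S \<omega>))"
  shows "(cmod (expectation S))\<^sup>2 / Re (expectation S)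
    \<le> expectation (\<lambda>\<omega>. (cmod (S \<omega>))\<^sup>2 / Re (S \<omega>))"
proof (cases "Re (expectation S) = 0")
  case True
  \<comment> \<open>Division by zero makes the left side of the goal 0, so nonnegativity
    suffices.\<close>
  have "0 \<le> expectation (\<lambda>\<omega>. (cmod (S \<omega>))\<^sup>2 / Re (S \<omega>))"
    using pos by (intro integral_nonneg_AE) (auto elim!: eventually_mono)
  then show ?thesis
    using True by simp
next
  case False
  \<comment> \<open>The slope of the ray through the mean of \<open>S\<close>: the tangent plane for
    this \<open>k\<close> touches the graph at that mean.\<close>
  define k where "k = Im (expectation S) / Re (expectation S)"
  have "(cmod (expectation S))\<^sup>2 / Re (expectation S)
      = (1 - k\<^sup>2) * Re (expectation S) + 2 * k * Im (expectation S)"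
    unfolding cmod_power2 k_def using False by (simp add: field_simps power2_eq_square)
  also have "\<dots> = expectation (\<lambda>\<omega>. (1 - k\<^sup>2) * Re (S \<omega>) + 2 * k * Im (S \<omega>))"
    using S by simp
  also have "\<dots> \<le> expectation (\<lambda>\<omega>. (cmod (S \<omega>))\<^sup>2 / Re (S \<omega>))"
    using S Q pos
    by (intro integral_mono_AE) (auto elim!: eventually_mono intro: norm_square_divide_Re_tangent)
  finally show ?thesis .
qed

lemma (in prob_space) expectation_pos:
  fixes X :: "'a \<Rightarrow> real"
  assumes "integrable M X" "AE \<omega> in M. X \<omega> > 0"
  shows "expectation X > 0"
  using integral_less_AE_space[of "\<lambda>_. 0" X] assms by (simp add: emeasure_space_1)

text \<open>Both means are homogeneous: \<open>v\<close> factors out of one and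
  \<open>inner c v\<close> out of the other, leaving the same harmonic mean of
  \<open>X\<close>.\<close>

lemma inner_complex_harmonic_mean_real_multiple:
  assumes "\<forall>\<omega>\<in>space M. Z \<omega> = v * complex_of_real (X \<omega>)"
  shows "inner c (complex_harmonic_mean M Z) = real_harmonic_mean M (\<lambda>\<omega>. inner c (Z \<omega>))"
proof -
  have "(\<integral>\<omega>. inverse (Z \<omega>) \<partial>M) = (\<integral>\<omega>. inverse v * complex_of_real (inverse (X \<omega>)) \<partial>M)"
    using assms by (intro Bochner_Integration.integral_cong) auto
  also have "\<dots> = inverse v * complex_of_real (\<integral>\<omega>. inverse (X \<omega>) \<partial>M)"
    by (simp only: integral_mult_right_zero integral_complex_of_real)
  finally have Z: "complex_harmonic_mean M Z = inverse (\<integral>\<omega>. inverse (X \<omega>) \<partial>M) *\<^sub>R v"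
    by (simp add: complex_harmonic_mean_def scaleR_conv_of_real)
  have "(\<integral>\<omega>. inverse (inner c (Z \<omega>)) \<partial>M) = (\<integral>\<omega>. inverse (inner c v) * inverse (X \<omega>) \<partial>M)"
  proof (rule Bochner_Integration.integral_cong)
    fix \<omega> assume "\<omega> \<in> space M"
    then have "Z \<omega> = X \<omega> *\<^sub>R v"
      using assms by (simp add: scaleR_conv_of_real)
    then show "inverse (inner c (Z \<omega>)) = inverse (inner c v) * inverse (X \<omega>)"
      by simp
  qed simp
  also have "\<dots> = inverse (inner c v) * (\<integral>\<omega>. inverse (X \<omega>) \<partial>M)"
    by (rule integral_mult_right_zero)
  finally show ?thesis
    by (simp add: Z real_harmonic_mean_def)
qed

theorem theorem4p1:
  fixes M :: "'a measure" and Z :: "'a \<Rightarrow> complex" and c :: complex and a R :: real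
  assumes "prob_space M"
    and "c \<noteq> 0"
    and "Z \<in> borel_measurable M"
    and "\<forall>\<omega>\<in>space M. Z \<omega> \<noteq> 0"
    and "a > 0"
    and "rv_range M Z \<subseteq> {z. inner c z \<ge> a} \<inter> {z. cmod z \<le> R}"
  shows "complex_harmonic_mean_exists M Z \<and>
         real_harmonic_mean_exists M (\<lambda>\<omega>. inner c (Z \<omega>)) \<and>
         inner c (complex_harmonic_mean M Z) \<ge> real_harmonic_mean M (\<lambda>\<omega>. inner c (Z \<omega>)) \<and>
         (\<forall>(v::complex) (X::'a \<Rightarrow> real).
            v \<noteq> 0 \<longrightarrow> X \<in> borel_measurable M \<longrightarrow> (\<forall>\<omega>\<in>space M. X \<omega> > 0) \<longrightarrow>
            (\<forall>\<omega>\<in>space M. Z \<omega> = v * complex_of_real (X \<omega>)) \<longrightarrow>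
            inner c (complex_harmonic_mean M Z) = real_harmonic_mean M (\<lambda>\<omega>. inner c (Z \<omega>)))"
proof -
  interpret prob_space M by fact
  note [measurable] = \<open>Z \<in> borel_measurable M\<close>
  let ?S = "\<lambda>\<omega>. c / Z \<omega>"
  have ge: "AE \<omega> in M. inner c (Z \<omega>) \<ge> a"
    using AE_in_rv_range[OF \<open>prob_space M\<close> \<open>Z \<in> borel_measurable M\<close>]
    by eventually_elim (use assms(6) in auto)
  then have pos: "AE \<omega> in M. inner c (Z \<omega>) > 0"
    by eventually_elim (use \<open>a > 0\<close> in auto)
  have nz: "AE \<omega> in M. Z \<omega> \<noteq> 0"
    using assms(4) by (intro AE_I2) auto
  have intZ: "integrable M (\<lambda>\<omega>. inverse (Z \<omega>))"
  proof (rule integrable_const_bound)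
    \<comment> \<open>By Cauchy-Schwarz, \<open>inner c (Z \<omega>) \<ge> a\<close> keeps
      \<open>Z\<close> at distance at least \<open>a / cmod c\<close> from 0.\<close>
    show "AE \<omega> in M. norm (inverse (Z \<omega>)) \<le> inverse (a / cmod c)"
      using ge
    proof eventually_elim
      case (elim \<omega>)
      then have "a \<le> cmod c * cmod (Z \<omega>)"
        using norm_cauchy_schwarz[of c "Z \<omega>"] by linarith
      then have "a / cmod c \<le> cmod (Z \<omega>)"
        using \<open>c \<noteq> 0\<close> by (simp add: field_simps)
      moreover have "0 < a / cmod c"
        using \<open>a > 0\<close> \<open>c \<noteq> 0\<close> by simp
      ultimately show ?case
        unfolding norm_inverse by (rule le_imp_inverse_le)
    qed
  qed simp
  have intI: "integrable M (\<lambda>\<omega>. inverse (inner c (Z \<omega>)))"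
  proof (rule integrable_const_bound)
    show "AE \<omega> in M. norm (inverse (inner c (Z \<omega>))) \<le> inverse a"
      using ge by eventually_elim (use \<open>a > 0\<close> in \<open>simp add: le_imp_inverse_le\<close>)
  qed simp
  have I_pos: "expectation (\<lambda>\<omega>. inverse (inner c (Z \<omega>))) > 0"
    using intI pos by (intro expectation_pos) (auto elim!: eventually_mono)
  have intS: "integrable M ?S"
    using integrable_mult_right[OF intZ, of c] by (simp add: divide_inverse)
  have ReS: "AE \<omega> in M. Re (?S \<omega>) > 0"
    using pos nz by eventually_elim (simp add: Re_divide_eq_inner)
  \<comment> \<open>Averaging within the open half-plane keeps the mean of \<open>?S\<close> there.
    Hence the mean of \<open>1 / Z\<close> cannot cancel to 0, and \<open>inner c\<close> of the
    harmonic mean is positive.\<close>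
  have "expectation (\<lambda>\<omega>. Re (?S \<omega>)) > 0"
    using intS ReS by (intro expectation_pos) auto
  then have ReES: "Re (expectation ?S) > 0"
    using intS by simp
  have ES: "expectation ?S = c / complex_harmonic_mean M Z"
    by (simp add: divide_inverse complex_harmonic_mean_def)
  have H_pos: "inner c (complex_harmonic_mean M Z) > 0"
    using ReES by (auto simp: ES Re_divide_eq_inner zero_less_divide_iff not_sum_power2_lt_zero)
  have Q: "(\<lambda>\<omega>. (cmod (?S \<omega>))\<^sup>2 / Re (?S \<omega>)) = (\<lambda>\<omega>. (cmod c)\<^sup>2 * inverse (inner c (Z \<omega>)))"
    unfolding norm_square_divide_inner[symmetric] by (simp only: divide_inverse)
  \<comment> \<open>The identity \<open>norm_square_divide_inner\<close> is now used at the harmonic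
    mean itself, as \<open>Q\<close> used it at each \<open>Z \<omega>\<close>; Jensen's inequality
    links the two.\<close>
  have "(cmod c)\<^sup>2 / inner c (complex_harmonic_mean M Z)
      = (cmod (expectation ?S))\<^sup>2 / Re (expectation ?S)"
    by (simp only: ES norm_square_divide_inner)
  also have "\<dots> \<le> expectation (\<lambda>\<omega>. (cmod (?S \<omega>))\<^sup>2 / Re (?S \<omega>))"
  proof (rule expectation_norm_square_divide_Re[OF intS ReS])
    show "integrable M (\<lambda>\<omega>. (cmod (?S \<omega>))\<^sup>2 / Re (?S \<omega>))"
      unfolding Q using intI by simp
  qed
  also have "\<dots> = (cmod c)\<^sup>2 * expectation (\<lambda>\<omega>. inverse (inner c (Z \<omega>)))"
    unfolding Q by simp
  finally have "inverse (inner c (complex_harmonic_mean M Z))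
      \<le> expectation (\<lambda>\<omega>. inverse (inner c (Z \<omega>)))"
    using \<open>c \<noteq> 0\<close> by (simp add: divide_inverse)
  then have le: "real_harmonic_mean M (\<lambda>\<omega>. inner c (Z \<omega>)) \<le> inner c (complex_harmonic_mean M Z)"
    unfolding real_harmonic_mean_def
    using H_pos le_imp_inverse_le[of "inverse (inner c (complex_harmonic_mean M Z))"] by simp
  \<comment> \<open>Were the integral 0, then \<open>inverse 0 = 0\<close> would make the harmonic
    mean 0, against \<open>H_pos\<close>.\<close>
  have "(\<integral>\<omega>. inverse (Z \<omega>) \<partial>M) \<noteq> 0"
    using H_pos by (auto simp: complex_harmonic_mean_def)
  then show ?thesis
    using nz intZ pos intI I_pos le inner_complex_harmonic_mean_real_multiple
    unfolding complex_harmonic_mean_exists_def real_harmonic_mean_exists_def by blast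
qed

end
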